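(* Let $\kappa\in\mathbb{C}$, let $q>1$ be a real number, let $m$ be a positive integer, let $\Phi_0,\dots,\Phi_{m-1}$ be $1$-periodic Hölder continuous functions with exponent $\alpha>0$, and let $0<\beta<\alpha$. Then there exist continuously differentiable functions $\Psi_{-1},\Psi_0,\dots,\Psi_{m-1}$, periodic with period $1$, and a constant $c$ such that $$\sum_{1\le n<N}n^\kappa\sum_{\substack{j+k=m-1\\ 0\le j<m}}\frac{(\log n)^k}{k!}\Phi_j(\log_q n)=c+N^{\kappa+1}\sum_{\substack{k+j=m-1\\ -1\le j<m}}\frac{(\log N)^k}{k!}\Psi_j(\log_q N)+O\bigl(N^{\Re\kappa+1-\beta}\bigr)$$ for integers $N\to\infty$. Denote the Fourier coefficients of $\Phi_j$ and $\Psi_j$ by $\varphi_{j\ell}=\int_0^1\Phi_j(u)\exp(-2\ell\pi i u)\,\mathrm{d}u$ and $\psi_{j\ell}=\int_0^1\Psi_j(u)\exp(-2\ell\pi i u)\,\mathrm{d}u$, respectively. Then the corresponding generating functions fulfil $$\sum_{0\le j<m}\varphi_{j\ell}Z^j=\Bigl(\kappa+1+\frac{2\ell\pi i}{\log q}+Z\Bigr)\sum_{-1\le j<m}\psi_{j\ell}Z^j+O(Z^m)$$ for $\ell\in\mathbb{Z}$ and $Z\to 0$. If $q^{\kappa+1}\ne 1$, then $\Psi_{-1}$ vanishes.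
   Context: The functions $\Phi_j$ and $\Psi_j$ are complex-valued functions on $\mathbb{R}$. In the sums, $k$ is determined by $j$ via $k=m-1-j$.
   Formalization: The Hölder exponent is restricted to 0<α≤1; for α>1 only constant functions are Hölder and the claim fails, e.g. m=1, Φ_0=1, κ=1, β=2: the relation forces Ψ_0=1/2, Ψ_{-1}=0, leaving an error of order N instead of O(1). *)

theory Defs
  imports "HOL-Analysis.Analysis" "HOL-Library.Landau_Symbols"
begin

definition hoelder_continuous_on :: "real \<Rightarrow> 'a set \<Rightarrow> ('a::metric_space \<Rightarrow> 'b::metric_space) \<Rightarrow> bool"
  where "hoelder_continuous_on \<alpha> S f \<longleftrightarrow>
    (\<exists>C. \<forall>x\<in>S. \<forall>y\<in>S. dist (f x) (f y) \<le> C * dist x y powr \<alpha>)"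

definition fourier_coeff :: "(real \<Rightarrow> complex) \<Rightarrow> int \<Rightarrow> complex"
  where "fourier_coeff f l =
    integral {0..1} (\<lambda>u. f u * exp (- 2 * of_int l * of_real pi * \<i> * of_real u))"

end

theory Submission
  imports Defs
begin

text \<open>
  Put \<open>\<tau> = ln q\<close> and \<open>u = log q t\<close>. The summand is the restriction to the integers of
  \<open>g t = t\<^sup>\<kappa> \<Sum> (ln t)\<^sup>k / k! \<Phi>\<^sub>j u\<close>, and the claimed main term is that of an antiderivative of \<open>g\<close> which has
  the same shape. Differentiating \<open>t\<^sup>\<kappa>\<^sup>+\<^sup>1 \<Sum> (ln t)\<^sup>k / k! \<Psi>\<^sub>j u\<close> and comparing the coefficients of
  \<open>(ln t)\<^sup>k / k!\<close> shows that it is an antiderivative of \<open>g\<close> once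
  \<open>\<Psi>\<^sub>j' / \<tau> + (\<kappa> + 1) \<Psi>\<^sub>j = \<Phi>\<^sub>j - \<Psi>\<^sub>j\<^sub>-\<^sub>1\<close> for all \<open>j\<close>, where the right-hand side is \<open>0\<close> for \<open>j = -1\<close>
  (\<open>log_polynomial_antiderivative\<close>).

  This tower of linear differential equations is solved by periodic functions from the bottom up
  (\<open>periodic_ode_tower\<close>). If \<open>q\<^sup>\<kappa>\<^sup>+\<^sup>1 \<noteq> 1\<close>, every periodic right-hand side admits a periodic solution, and
  \<open>\<Psi>\<^sub>-\<^sub>1 = 0\<close> will do. In the resonant case \<open>q\<^sup>\<kappa>\<^sup>+\<^sup>1 = 1\<close> the right-hand side has to be orthogonal to one
  exponential function; but then the solution at each level is determined only up to a multiple of the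
  homogeneous solution, and this freedom is spent on making the next level solvable. Taking Fourier
  coefficients of the equations gives the relation between the generating functions, with the single
  term \<open>\<psi>\<^sub>m\<^sub>-\<^sub>1\<^sub>,\<^sub>\<ell> Z\<^sup>m\<close> left over.

  For the error, the difference between \<open>g n\<close> and the increment of the antiderivative over
  \<open>[n, n + 1]\<close> is at most the oscillation of \<open>g\<close> on that interval. Hoelder continuity makes it
  \<open>O(n powr (Re \<kappa> - \<gamma>))\<close> for each \<open>\<gamma> < \<alpha>\<close>, the gap to \<open>\<alpha>\<close> absorbing the logarithms. With
  \<open>\<beta> < \<gamma> < \<alpha>\<close> and \<open>\<gamma> \<noteq> Re \<kappa> + 1\<close> the sum of these differences is a constant plus
  \<open>O(N powr (Re \<kappa> + 1 - \<gamma>))\<close>, whether it diverges or converges (\<open>sum_powr_bounded_asymptotics\<close>).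
\<close>

section \<open>Periodic solutions of a linear differential equation\<close>

lemma continuous_antiderivative:
  fixes f :: "real \<Rightarrow> complex"
  assumes "continuous_on UNIV f"
  obtains F where "\<And>x. (F has_vector_derivative f x) (at x)"
proof -
  have "\<exists>F. \<forall>x::real. (-\<infinity>::ereal) < x \<longrightarrow> x < (\<infinity>::ereal) \<longrightarrow> (F has_vector_derivative f x) (at x)"
    using assms by (intro einterval_antiderivative) (auto simp: continuous_on_eq_continuous_at)
  then show thesis
    using that by auto
qed

lemma has_vector_derivative_integral_01:
  fixes F :: "real \<Rightarrow> complex"
  assumes "\<And>x. (F has_vector_derivative f x) (at x)"
  shows "(f has_integral (F 1 - F 0)) {0..1}"
  by (rule fundamental_theorem_of_calculus)
    (auto intro: has_vector_derivative_at_within assms)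

lemma has_vector_derivative_exp_real:
  fixes a :: complex
  shows "((\<lambda>u. exp (a * of_real u)) has_vector_derivative a * exp (a * of_real u)) (at u)"
proof -
  have "((\<lambda>z. exp (a * z)) has_field_derivative a * exp (a * of_real u)) (at (of_real u))"
    by (auto intro!: derivative_eq_intros)
  from has_vector_derivative_real_field[OF this] show ?thesis .
qed

text \<open>
  The equation \<open>y' / \<tau> + \<mu> y = G\<close>, solved for the derivative. The factor \<open>1 / \<tau>\<close> is the one that the chain
  rule produces for \<open>\<lambda>t. y (ln t / \<tau>)\<close>.
\<close>
definition periodic_ode_solution :: "complex \<Rightarrow> real \<Rightarrow> (real \<Rightarrow> complex) \<Rightarrow> (real \<Rightarrow> complex) \<Rightarrow> bool"
  where "periodic_ode_solution \<mu> \<tau> G y \<longleftrightarrow> (\<forall>u. y (u + 1) = y u) \<and>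
    (\<forall>u. (y has_vector_derivative of_real \<tau> * (G u - \<mu> * y u)) (at u))"

text \<open>
  The Fredholm alternative: multiplying the equation by the integrating factor \<open>exp (\<mu> * \<tau> * u)\<close> turns it
  into \<open>(exp (\<mu> * \<tau> * u) * y)' = \<tau> * exp (\<mu> * \<tau> * u) * G\<close>. When the integrating factor is itself periodic, a
  periodic \<open>y\<close> forces the right-hand side to have mean zero.
\<close>
definition solvable_rhs :: "complex \<Rightarrow> real \<Rightarrow> (real \<Rightarrow> complex) \<Rightarrow> bool"
  where "solvable_rhs \<mu> \<tau> G \<longleftrightarrow> exp (\<mu> * of_real \<tau>) = 1 \<longrightarrow>
    ((\<lambda>u. exp (\<mu> * of_real \<tau> * of_real u) * G u) has_integral 0) {0..1}"

text \<open>
  The integrating factor makes \<open>exp (a * u) * y u\<close> constant.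
\<close>
lemma homogeneous_ode_unique:
  fixes y :: "real \<Rightarrow> complex"
  assumes "\<And>u. (y has_vector_derivative - a * y u) (at u)" "y 0 = 0"
  shows "y u = 0"
proof -
  have "((\<lambda>u. exp (a * of_real u) * y u) has_vector_derivative 0) (at x within UNIV)" for x
    using has_vector_derivative_mult[OF has_vector_derivative_exp_real[of a x] assms(1)[of x]]
    by (simp add: algebra_simps)
  then obtain c where "\<And>x. exp (a * of_real x) * y x = c"
    using has_vector_derivative_zero_constant[of UNIV "\<lambda>u. exp (a * of_real u) * y u"]
    by auto
  from this[of u] this[of 0] show ?thesis
    using assms(2) by simp
qed

text \<open>
  One level of the tower. Variation of constants gives a one-parameter family of solutions \<open>y\<^sub>C\<close>. Off
  resonance \<open>C\<close> is used to match the values at \<open>0\<close> and \<open>1\<close>. In the resonant case these match for every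
  \<open>C\<close> by the solvability of \<open>G\<close>, and \<open>C\<close> is used to make the next right-hand side \<open>H - y\<^sub>C\<close> solvable: the
  homogeneous solution \<open>exp (- a * u)\<close> contributes exactly \<open>C\<close> to the obstruction integral.
\<close>
lemma periodic_ode_step:
  assumes "\<tau> > 0"
    and "continuous_on UNIV G" "\<And>u. G (u + 1) = G u" "solvable_rhs \<mu> \<tau> G"
    and "continuous_on UNIV H"
  obtains y where "periodic_ode_solution \<mu> \<tau> G y" "solvable_rhs \<mu> \<tau> (\<lambda>u. H u - y u)"
proof -
  define a where "a = \<mu> * of_real \<tau>"
  define g where "g u = of_real \<tau> * (exp (a * of_real u) * G u)" for u :: real
  have "continuous_on UNIV g"
    unfolding g_def by (intro continuous_intros assms)
  then obtain A where A: "\<And>u. (A has_vector_derivative g u) (at u)"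
    using continuous_antiderivative by blast
  define y where "y C u = exp (- a * of_real u) * (A u + C)" for C and u :: real
  have y: "(y C has_vector_derivative of_real \<tau> * (G u - \<mu> * y C u)) (at u)" for C u
  proof -
    have "((\<lambda>u. exp (- a * of_real u) * (A u + C)) has_vector_derivative
        exp (- a * of_real u) * g u + (- a * exp (- a * of_real u)) * (A u + C)) (at u)"
      using A[of u] by (intro has_vector_derivative_mult has_vector_derivative_exp_real)
        (auto intro!: derivative_eq_intros)
    moreover have "exp (- a * of_real u) * g u = of_real \<tau> * G u"
      by (simp add: g_def mult_ac exp_minus)
    ultimately show ?thesis
      unfolding y_def by (simp add: algebra_simps a_def)
  qed
  have periodic: "y C (u + 1) = y C u" if "y C 1 = y C 0" for C u
  proof -
    \<comment> \<open>both \<open>y C\<close> and its translate solve the equation, so their difference solves the homogeneous one\<close>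
    have sh: "((\<lambda>u. y C (u + 1)) has_vector_derivative of_real \<tau> * (G u - \<mu> * y C (u + 1))) (at u)" for u
    proof -
      have "((y C \<circ> (\<lambda>u. u + 1)) has_vector_derivative 1 *\<^sub>R (of_real \<tau> * (G (u + 1) - \<mu> * y C (u + 1)))) (at u)"
        by (intro vector_diff_chain_at y) (auto intro!: derivative_eq_intros)
      then show ?thesis
        using assms(3) by (simp add: o_def)
    qed
    have "y C (u + 1) - y C u = 0"
      by (rule homogeneous_ode_unique[of "\<lambda>u. y C (u + 1) - y C u" a])
        (use has_vector_derivative_diff[OF sh y] that in \<open>auto simp: a_def algebra_simps\<close>)
    then show ?thesis by simp
  qed
  show thesis
  proof (cases "exp a = 1")
    case False
    \<comment> \<open>the unique solution of \<open>y C 1 = y C 0\<close>\<close>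
    define C where "C = (A 1 - exp a * A 0) / (exp a - 1)"
    have C: "C * (exp a - 1) = A 1 - exp a * A 0"
      using False by (simp add: C_def)
    have "A 1 + C = exp a * (A 0 + C)"
      using C by (simp add: algebra_simps)
    then have "y C 1 = y C 0"
      by (simp add: y_def exp_minus)
    then have "periodic_ode_solution \<mu> \<tau> G (y C)"
      unfolding periodic_ode_solution_def using y periodic by blast
    moreover have "solvable_rhs \<mu> \<tau> (\<lambda>u. H u - y C u)"
      using False by (simp add: solvable_rhs_def a_def)
    ultimately show thesis
      by (rule that)
  next
    case True
    have "(g has_integral of_real \<tau> * 0) {0..1}"
      unfolding g_def using assms(4) True
      by (intro has_integral_mult_right) (simp add: solvable_rhs_def a_def)
    then have "A 1 - A 0 = 0"
      using has_integral_unique[OF has_vector_derivative_integral_01[OF A]] by simp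
    then have "A 1 = A 0"
      by simp
    have "exp (- a) = 1"
      using True by (simp add: exp_minus)
    then have "y C 1 = y C 0" for C
      using \<open>A 1 = A 0\<close> by (simp add: y_def)
    then have sol: "periodic_ode_solution \<mu> \<tau> G (y C)" for C
      unfolding periodic_ode_solution_def using y periodic by blast
    \<comment> \<open>the value of \<open>C\<close> that cancels the obstruction for \<open>H - y C\<close>\<close>
    define C where "C = integral {0..1} (\<lambda>u. exp (a * of_real u) * H u - A u)"
    have "continuous_on {0..1} A"
      by (meson A continuous_at_imp_continuous_on has_vector_derivative_continuous)
    then have "((\<lambda>u. exp (a * of_real u) * H u - A u) has_integral C) {0..1}"
      unfolding C_def
      by (intro integrable_integral integrable_continuous_real continuous_intros)
        (auto intro: continuous_on_subset[OF assms(5)])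
    from has_integral_diff[OF this has_integral_const_real[of C 0 1]]
    have "((\<lambda>u. exp (a * of_real u) * H u - A u - C) has_integral 0) {0..1}"
      by simp
    moreover have "exp (a * of_real u) * H u - A u - C = exp (a * of_real u) * (H u - y C u)" for u
      by (simp add: y_def exp_minus algebra_simps)
    ultimately have "solvable_rhs \<mu> \<tau> (\<lambda>u. H u - y C u)"
      by (simp add: solvable_rhs_def a_def)
    with sol show thesis
      by (rule that)
  qed
qed

lemma periodic_ode_solution_C1:
  assumes "periodic_ode_solution \<mu> \<tau> G y" "continuous_on UNIV G"
  shows "continuous_on UNIV y" "y C1_differentiable_on UNIV"
proof -
  have y: "(y has_vector_derivative of_real \<tau> * (G u - \<mu> * y u)) (at u)" for u
    using assms(1) by (simp add: periodic_ode_solution_def)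
  show cont: "continuous_on UNIV y"
    by (meson y continuous_at_imp_continuous_on has_vector_derivative_continuous)
  show "y C1_differentiable_on UNIV"
    unfolding C1_differentiable_on_def
    by (intro exI[of _ "\<lambda>u. of_real \<tau> * (G u - \<mu> * y u)"] conjI ballI y
        continuous_intros assms cont)
qed

text \<open>
  The solutions are chosen successively, each solution carrying along that the next right-hand side is
  solvable. Here \<open>y n\<close> plays the part of \<open>\<Psi>\<^sub>n\<^sub>-\<^sub>1\<close>, the bottom level \<open>y 0\<close> being a homogeneous solution.
  Off resonance this bottom solution is zero. In the resonant case it need not vanish, as it has to make
  \<open>F 0 - y 0\<close> solvable.
\<close>
lemma periodic_ode_tower:
  fixes F :: "nat \<Rightarrow> real \<Rightarrow> complex"
  assumes "\<tau> > 0" "\<And>n. continuous_on UNIV (F n)" "\<And>n u. F n (u + 1) = F n u"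
  obtains y :: "nat \<Rightarrow> real \<Rightarrow> complex"
  where "periodic_ode_solution \<mu> \<tau> (\<lambda>_. 0) (y 0)"
    and "\<And>n. periodic_ode_solution \<mu> \<tau> (\<lambda>u. F n u - y n u) (y (Suc n))"
    and "\<And>n. continuous_on UNIV (y n)" "\<And>n. y n C1_differentiable_on UNIV"
    and "exp (\<mu> * of_real \<tau>) \<noteq> 1 \<Longrightarrow> y 0 = (\<lambda>_. 0)"
proof -
  define P where "P n z \<longleftrightarrow> solvable_rhs \<mu> \<tau> (\<lambda>u. F n u - z u) \<and> z C1_differentiable_on UNIV
    \<and> continuous_on UNIV z \<and> (\<forall>u. z (u + 1) = z u) \<and> (n = 0 \<longrightarrow> periodic_ode_solution \<mu> \<tau> (\<lambda>_. 0) z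
    \<and> (exp (\<mu> * of_real \<tau>) \<noteq> 1 \<longrightarrow> z = (\<lambda>_. 0)))" for n z
  define Q where "Q n z w \<longleftrightarrow> periodic_ode_solution \<mu> \<tau> (\<lambda>u. F n u - z u) w" for n and z w :: "real \<Rightarrow> complex"
  have "\<exists>y. \<forall>n. P n (y n) \<and> Q n (y n) (y (Suc n))"
  proof (rule dependent_nat_choice)
    show "\<exists>z. P 0 z"
    proof (cases "exp (\<mu> * of_real \<tau>) = 1")
      case True
      obtain z where z: "periodic_ode_solution \<mu> \<tau> (\<lambda>_. 0) z" "solvable_rhs \<mu> \<tau> (\<lambda>u. F 0 u - z u)"
      proof (rule periodic_ode_step[OF assms(1), of "\<lambda>_. 0" \<mu> "F 0"])
        show "solvable_rhs \<mu> \<tau> (\<lambda>_. 0)"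
          by (simp add: solvable_rhs_def)
      qed (use assms(2) in auto)
      then have "P 0 z"
        using True periodic_ode_solution_C1[OF z(1)] by (simp add: P_def periodic_ode_solution_def)
      then show ?thesis by blast
    next
      case False
      then have "P 0 (\<lambda>_. 0)"
        by (simp add: P_def solvable_rhs_def periodic_ode_solution_def)
      then show ?thesis by blast
    qed
    fix z n assume z: "P n z"
    have cont: "continuous_on UNIV (\<lambda>u. F n u - z u)"
      using z by (intro continuous_on_diff assms(2)) (simp add: P_def)
    obtain w where w: "periodic_ode_solution \<mu> \<tau> (\<lambda>u. F n u - z u) w"
      "solvable_rhs \<mu> \<tau> (\<lambda>u. F (Suc n) u - w u)"
    proof (rule periodic_ode_step[OF assms(1) cont, of \<mu> "F (Suc n)"])
      show "F n (u + 1) - z (u + 1) = F n u - z u" for u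
        using z assms(3) by (simp add: P_def)
      show "solvable_rhs \<mu> \<tau> (\<lambda>u. F n u - z u)"
        using z by (simp add: P_def)
    qed (use assms(2) in auto)
    then have "P (Suc n) w \<and> Q n z w"
      using periodic_ode_solution_C1[OF w(1) cont] by (simp add: P_def Q_def periodic_ode_solution_def)
    then show "\<exists>w. P (Suc n) w \<and> Q n z w" by (intro exI[of _ w])
  qed
  then obtain y where PQ: "\<forall>n. P n (y n) \<and> Q n (y n) (y (Suc n))"
    by (rule exE)
  have P: "P n (y n)" and Q: "Q n (y n) (y (Suc n))" for n
    using PQ by simp_all
  show thesis
  proof (rule that)
    show "periodic_ode_solution \<mu> \<tau> (\<lambda>_. 0) (y 0)" "exp (\<mu> * of_real \<tau>) \<noteq> 1 \<Longrightarrow> y 0 = (\<lambda>_. 0)"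
      using P[of 0] unfolding P_def by simp_all
    show "periodic_ode_solution \<mu> \<tau> (\<lambda>u. F n u - y n u) (y (Suc n))" for n
      using Q[of n] unfolding Q_def .
    show "continuous_on UNIV (y n)" "y n C1_differentiable_on UNIV" for n
      using P[of n] unfolding P_def by simp_all
  qed
qed

text \<open>
  Integrating the derivative of \<open>y u * exp (- 2 * l * pi * \<i> * u)\<close> over a period gives zero; this is
  the differential equation on the side of the Fourier coefficients.
\<close>
lemma fourier_coeff_ode:
  assumes "periodic_ode_solution \<mu> \<tau> G y" "\<tau> > 0" "continuous_on UNIV G"
  shows "fourier_coeff G l = (\<mu> + 2 * of_int l * of_real pi * \<i> / of_real \<tau>) * fourier_coeff y l"
proof -
  define b :: complex where "b = - 2 * of_int l * of_real pi * \<i>"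
  define e where "e u = exp (b * of_real u)" for u :: real
  have y: "(y has_vector_derivative of_real \<tau> * (G u - \<mu> * y u)) (at u)" for u
    using assms(1) by (simp add: periodic_ode_solution_def)
  have "((\<lambda>u. y u * e u) has_vector_derivative
      y u * (b * e u) + of_real \<tau> * (G u - \<mu> * y u) * e u) (at u)" for u
    unfolding e_def by (intro has_vector_derivative_mult y has_vector_derivative_exp_real)
  from has_vector_derivative_integral_01[OF this]
  have "((\<lambda>u. y u * (b * e u) + of_real \<tau> * (G u - \<mu> * y u) * e u) has_integral
      (y 1 * e 1 - y 0 * e 0)) {0..1}" .
  moreover have "e 1 = 1"
  proof -
    have "b = 2 * of_int (- l) * of_real pi * \<i>" by (simp add: b_def)
    then show ?thesis
      unfolding e_def using exp_eq_1[of b] by (auto intro!: exI[of _ "- l"])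
  qed
  moreover have "e 0 = 1" by (simp add: e_def)
  moreover have "y 1 = y 0"
    using assms(1) unfolding periodic_ode_solution_def by (metis add_0)
  ultimately have 1: "((\<lambda>u. y u * (b * e u) + of_real \<tau> * (G u - \<mu> * y u) * e u) has_integral 0) {0..1}"
    by simp
  have "continuous_on UNIV e"
    unfolding e_def by (intro continuous_intros)
  have fc: "((\<lambda>u. f u * e u) has_integral fourier_coeff f l) {0..1}" if "continuous_on UNIV f" for f
    unfolding fourier_coeff_def e_def b_def
    by (intro integrable_integral integrable_continuous_real continuous_intros
        continuous_on_subset[OF that]) auto
  have "((\<lambda>u. of_real \<tau> * (G u * e u) + (b - of_real \<tau> * \<mu>) * (y u * e u)) has_integral
      (of_real \<tau> * fourier_coeff G l + (b - of_real \<tau> * \<mu>) * fourier_coeff y l)) {0..1}"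
    by (intro has_integral_add has_integral_mult_right fc assms(3)
        periodic_ode_solution_C1[OF assms(1,3)])
  moreover have "(\<lambda>u. of_real \<tau> * (G u * e u) + (b - of_real \<tau> * \<mu>) * (y u * e u))
      = (\<lambda>u. y u * (b * e u) + of_real \<tau> * (G u - \<mu> * y u) * e u)"
    by (intro ext) (simp add: algebra_simps)
  ultimately have "of_real \<tau> * fourier_coeff G l + (b - of_real \<tau> * \<mu>) * fourier_coeff y l = 0"
    using has_integral_unique[OF _ 1] by simp
  then have "of_real \<tau> * fourier_coeff G l = (of_real \<tau> * \<mu> - b) * fourier_coeff y l"
    by (simp add: algebra_simps)
  also have "of_real \<tau> * \<mu> - b = of_real \<tau> * (\<mu> + 2 * of_int l * of_real pi * \<i> / of_real \<tau>)"
    using assms(2) by (simp add: b_def distrib_left)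
  finally show ?thesis
    using assms(2) by (simp add: mult.assoc)
qed

lemma fourier_coeff_diff:
  assumes "continuous_on UNIV f" "continuous_on UNIV g"
  shows "fourier_coeff (\<lambda>u. f u - g u) l = fourier_coeff f l - fourier_coeff g l"
  unfolding fourier_coeff_def left_diff_distrib
  by (intro integral_diff integrable_continuous_real continuous_intros
      continuous_on_subset[OF assms(1)] continuous_on_subset[OF assms(2)]) auto

section \<open>Antiderivatives with logarithmic factors\<close>

text \<open>
  The derivative is computed in the variable \<open>s = ln t\<close>. There \<open>exp ((\<kappa> + 1) * s)\<close> contributes \<open>\<kappa> + 1\<close>, which
  the equations for \<open>y n\<close> cancel, and \<open>s ^ k / k!\<close> differentiates to \<open>s ^ (k - 1) / (k - 1)!\<close>. The latter
  moves \<open>y n\<close> to the place where level \<open>n + 1\<close> leaves \<open>F n - y n\<close>, so that only \<open>F n\<close> survives.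
  Finally \<open>ds = dt / t\<close> lowers the exponent by one.
\<close>
lemma log_polynomial_antiderivative:
  fixes y F :: "nat \<Rightarrow> real \<Rightarrow> complex"
  assumes "\<tau> > 0"
    and "periodic_ode_solution (\<kappa> + 1) \<tau> (\<lambda>_. 0) (y 0)"
    and "\<And>n. n < m \<Longrightarrow> periodic_ode_solution (\<kappa> + 1) \<tau> (\<lambda>u. F n u - y n u) (y (Suc n))"
    and "t > 0"
  shows "((\<lambda>t. exp ((\<kappa> + 1) * of_real (ln t)) *
      (\<Sum>n\<le>m. of_real (ln t) ^ (m - n) / fact (m - n) * y n (ln t / \<tau>))) has_vector_derivative
    exp (\<kappa> * of_real (ln t)) *
      (\<Sum>n<m. of_real (ln t) ^ (m - 1 - n) / fact (m - 1 - n) * F n (ln t / \<tau>))) (at t)"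
proof -
  define p :: "nat \<Rightarrow> real \<Rightarrow> complex" where "p k s = of_real s ^ k / fact k" for k s
  define E :: "real \<Rightarrow> complex" where "E s = exp ((\<kappa> + 1) * of_real s)" for s
  \<comment> \<open>the right-hand side of the equation satisfied by \<open>y n\<close>\<close>
  define G where "G n u = (case n of 0 \<Rightarrow> 0 | Suc n \<Rightarrow> F n u - y n u)" for n u
  have p: "(p (Suc k) has_vector_derivative p k s) (at s)" for k s
  proof -
    have "((\<lambda>z::complex. z ^ Suc k / fact (Suc k)) has_field_derivative
        of_nat (Suc k) * of_real s ^ k / fact (Suc k)) (at (of_real s))"
      by (intro DERIV_cdivide) (use DERIV_power[OF DERIV_ident, where n = "Suc k"] in simp)
    also have "of_nat (Suc k) * of_real s ^ k / fact (Suc k) = p k s"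
    proof -
      have "of_nat (Suc k) * of_real s ^ k / (of_nat (Suc k) * fact k) = of_real s ^ k / (fact k :: complex)"
        by (rule nonzero_mult_divide_mult_cancel_left) (simp del: of_nat_Suc)
      then show ?thesis
        by (simp add: p_def)
    qed
    finally have "((\<lambda>z::complex. z ^ Suc k / fact (Suc k)) has_field_derivative p k s) (at (of_real s))" .
    from has_vector_derivative_real_field[OF this] show ?thesis
      unfolding p_def .
  qed
  have p0: "(p 0 has_vector_derivative 0) (at s)" for s
    by (simp add: p_def[abs_def])
  have y: "((\<lambda>s. y n (s / \<tau>)) has_vector_derivative G n (s / \<tau>) - (\<kappa> + 1) * y n (s / \<tau>)) (at s)"
    if "n \<le> m" for n s
  proof -
    have "periodic_ode_solution (\<kappa> + 1) \<tau> (G n) (y n)"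
      using assms(2,3) that by (cases n) (auto simp: G_def[abs_def])
    then have "(y n has_vector_derivative of_real \<tau> * (G n u - (\<kappa> + 1) * y n u)) (at u)" for u
      by (simp add: periodic_ode_solution_def)
    moreover have "((\<lambda>s. s / \<tau>) has_vector_derivative 1 / \<tau>) (at s)"
      by (auto intro!: derivative_eq_intros)
    ultimately have "((y n \<circ> (\<lambda>s. s / \<tau>)) has_vector_derivative
        (1 / \<tau>) *\<^sub>R (of_real \<tau> * (G n (s / \<tau>) - (\<kappa> + 1) * y n (s / \<tau>)))) (at s)"
      using vector_diff_chain_at by blast
    then show ?thesis
      using assms(1) by (simp add: o_def scaleR_conv_of_real)
  qed
  have E: "(E has_vector_derivative (\<kappa> + 1) * E s) (at s)" for s
    unfolding E_def by (rule has_vector_derivative_exp_real)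
  \<comment> \<open>the derivative of \<open>p k\<close>, without a subtraction in the index\<close>
  define p' where "p' k s = (case k of 0 \<Rightarrow> 0 | Suc k \<Rightarrow> p k s)" for k s
  have p': "(p k has_vector_derivative p' k s) (at s)" for k s
    using p p0 by (cases k) (auto simp: p'_def)
  define H where "H s = E s * (\<Sum>n\<le>m. p (m - n) s * y n (s / \<tau>))" for s
  have H: "(H has_vector_derivative E s * (\<Sum>n<m. p (m - 1 - n) s * F n (s / \<tau>))) (at s)" for s
  proof -
    have "(H has_vector_derivative
        E s * (\<Sum>n\<le>m. p (m - n) s * (G n (s / \<tau>) - (\<kappa> + 1) * y n (s / \<tau>)) + p' (m - n) s * y n (s / \<tau>))
        + (\<kappa> + 1) * E s * (\<Sum>n\<le>m. p (m - n) s * y n (s / \<tau>))) (at s)"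
      unfolding H_def
      by (intro has_vector_derivative_mult has_vector_derivative_sum E p' y) auto
    also have "E s * (\<Sum>n\<le>m. p (m - n) s * (G n (s / \<tau>) - (\<kappa> + 1) * y n (s / \<tau>)) + p' (m - n) s * y n (s / \<tau>))
        + (\<kappa> + 1) * E s * (\<Sum>n\<le>m. p (m - n) s * y n (s / \<tau>))
      = E s * ((\<Sum>n\<le>m. p (m - n) s * G n (s / \<tau>)) + (\<Sum>n\<le>m. p' (m - n) s * y n (s / \<tau>)))"
      by (simp add: algebra_simps sum.distrib sum_subtractf sum_distrib_left)
    also have "(\<Sum>n\<le>m. p (m - n) s * G n (s / \<tau>)) = (\<Sum>n<m. p (m - 1 - n) s * (F n (s / \<tau>) - y n (s / \<tau>)))"
      by (subst sum.atMost_shift) (simp add: G_def)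
    also have "(\<Sum>n\<le>m. p' (m - n) s * y n (s / \<tau>)) = (\<Sum>n<m. p (m - 1 - n) s * y n (s / \<tau>))"
    proof -
      have "p' (m - n) s = p (m - 1 - n) s" if "n < m" for n
      proof -
        have "m - n = Suc (m - 1 - n)"
          using that by simp
        then show ?thesis
          by (simp only: p'_def nat.case)
      qed
      then show ?thesis
        by (simp add: p'_def flip: lessThan_Suc_atMost)
    qed
    finally show ?thesis
      by (simp add: right_diff_distrib sum_subtractf)
  qed
  have "(ln has_vector_derivative 1 / t) (at t)"
    using assms(4) by (auto simp flip: has_real_derivative_iff_has_vector_derivative intro!: derivative_eq_intros)
  from vector_diff_chain_at[OF this H]
  have "((\<lambda>t. H (ln t)) has_vector_derivative
      (1 / t) *\<^sub>R (E (ln t) * (\<Sum>n<m. p (m - 1 - n) (ln t) * F n (ln t / \<tau>)))) (at t)"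
    by (simp add: o_def)
  also have "(1 / t) *\<^sub>R (E (ln t) * (\<Sum>n<m. p (m - 1 - n) (ln t) * F n (ln t / \<tau>)))
      = exp (\<kappa> * of_real (ln t)) * (\<Sum>n<m. p (m - 1 - n) (ln t) * F n (ln t / \<tau>))"
  proof -
    have "E (ln t) = exp (\<kappa> * of_real (ln t)) * of_real t"
      using assms(4) by (simp add: E_def distrib_right exp_add exp_of_real)
    then show ?thesis
      using assms(4) by (simp add: scaleR_conv_of_real)
  qed
  finally show ?thesis
    by (simp add: H_def E_def p_def)
qed

section \<open>Oscillation on unit intervals\<close>

text \<open>
  Growth at most \<open>x powr r\<close>, and a gain of \<open>x powr - \<delta>\<close> for increments over steps of length at most \<open>1\<close>.
  With both bounds demanded together the notion is stable under products, the exponents \<open>r\<close> adding up, so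
  the bound for the summand can be read off from its factors.
\<close>
definition unit_step_bounded :: "real \<Rightarrow> real \<Rightarrow> (real \<Rightarrow> complex) \<Rightarrow> bool"
  where "unit_step_bounded r \<delta> f \<longleftrightarrow> (\<exists>C. \<forall>x\<ge>1.
    norm (f x) \<le> C * x powr r \<and> (\<forall>t\<in>{x..x+1}. norm (f t - f x) \<le> C * x powr (r - \<delta>)))"

lemma unit_step_boundedI:
  assumes "\<And>x. x \<ge> 1 \<Longrightarrow> norm (f x) \<le> A * x powr r"
    and "\<And>x t. x \<ge> 1 \<Longrightarrow> x \<le> t \<Longrightarrow> t \<le> x + 1 \<Longrightarrow> norm (f t - f x) \<le> B * x powr (r - \<delta>)"
  shows "unit_step_bounded r \<delta> f"
  unfolding unit_step_bounded_def
proof (intro exI[of _ "max A B"] allI impI conjI ballI)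
  fix x :: real assume x: "x \<ge> 1"
  have "norm (f x) \<le> A * x powr r"
    using assms(1) x .
  also have "\<dots> \<le> max A B * x powr r"
    by (intro mult_right_mono) auto
  finally show "norm (f x) \<le> max A B * x powr r" .
  fix t assume "t \<in> {x..x+1}"
  then have "norm (f t - f x) \<le> B * x powr (r - \<delta>)"
    using assms(2) x by simp
  also have "\<dots> \<le> max A B * x powr (r - \<delta>)"
    by (intro mult_right_mono) auto
  finally show "norm (f t - f x) \<le> max A B * x powr (r - \<delta>)" .
qed

lemma unit_step_boundedE:
  assumes "unit_step_bounded r \<delta> f"
  obtains C where "C \<ge> 0" "\<And>x. x \<ge> 1 \<Longrightarrow> norm (f x) \<le> C * x powr r"
    and "\<And>x t. x \<ge> 1 \<Longrightarrow> x \<le> t \<Longrightarrow> t \<le> x + 1 \<Longrightarrow> norm (f t - f x) \<le> C * x powr (r - \<delta>)"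
proof -
  from assms obtain C where C: "\<forall>x\<ge>1. norm (f x) \<le> C * x powr r
      \<and> (\<forall>t\<in>{x..x+1}. norm (f t - f x) \<le> C * x powr (r - \<delta>))"
    unfolding unit_step_bounded_def by blast
  have "norm (f 1) \<le> C"
    using C[rule_format, of 1] by simp
  then have "C \<ge> 0"
    using norm_ge_zero order_trans by blast
  then show thesis
    using C by (intro that[of C]) auto
qed

lemma unit_step_bounded_weaken:
  assumes "unit_step_bounded r \<delta> f" "r \<le> r'"
  shows "unit_step_bounded r' \<delta> f"
proof -
  from assms(1) obtain C where C: "C \<ge> 0" "\<And>x. x \<ge> 1 \<Longrightarrow> norm (f x) \<le> C * x powr r"
    "\<And>x t. x \<ge> 1 \<Longrightarrow> x \<le> t \<Longrightarrow> t \<le> x + 1 \<Longrightarrow> norm (f t - f x) \<le> C * x powr (r - \<delta>)"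
    by (rule unit_step_boundedE) blast
  show ?thesis
  proof (rule unit_step_boundedI)
    fix x :: real assume x: "x \<ge> 1"
    show "norm (f x) \<le> C * x powr r'"
      by (rule order_trans[OF C(2)[OF x]]) (intro mult_left_mono powr_mono assms C x)
    fix t assume t: "x \<le> t" "t \<le> x + 1"
    show "norm (f t - f x) \<le> C * x powr (r' - \<delta>)"
      by (rule order_trans[OF C(3)[OF x t]])
        (intro mult_left_mono powr_mono C x, use assms in auto)
  qed
qed

text \<open>
  The product rule \<open>\<Delta>(f * g) = \<Delta>f * g + f * \<Delta>g\<close>: in each term one factor contributes the gain.
\<close>
lemma unit_step_bounded_mult:
  assumes "unit_step_bounded r \<delta> f" "unit_step_bounded s \<delta> g" "\<delta> \<ge> 0"
  shows "unit_step_bounded (r + s) \<delta> (\<lambda>x. f x * g x)"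
proof -
  from assms(1) obtain A where A: "A \<ge> 0" "\<And>x. x \<ge> 1 \<Longrightarrow> norm (f x) \<le> A * x powr r"
    "\<And>x t. x \<ge> 1 \<Longrightarrow> x \<le> t \<Longrightarrow> t \<le> x + 1 \<Longrightarrow> norm (f t - f x) \<le> A * x powr (r - \<delta>)"
    by (rule unit_step_boundedE) blast
  from assms(2) obtain B where B: "B \<ge> 0" "\<And>x. x \<ge> 1 \<Longrightarrow> norm (g x) \<le> B * x powr s"
    "\<And>x t. x \<ge> 1 \<Longrightarrow> x \<le> t \<Longrightarrow> t \<le> x + 1 \<Longrightarrow> norm (g t - g x) \<le> B * x powr (s - \<delta>)"
    by (rule unit_step_boundedE) blast
  show ?thesis
  proof (rule unit_step_boundedI)
    fix x :: real assume x: "x \<ge> 1"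
    have "norm (f x * g x) \<le> (A * x powr r) * (B * x powr s)"
      unfolding norm_mult by (intro mult_mono A B x mult_nonneg_nonneg) auto
    then show "norm (f x * g x) \<le> (A * B) * x powr (r + s)"
      by (simp add: powr_add mult_ac)
    fix t assume t: "x \<le> t" "t \<le> x + 1"
    have "norm (g t) \<le> norm (g x) + norm (g t - g x)"
      using norm_triangle_ineq[of "g x" "g t - g x"] by simp
    also have "\<dots> \<le> B * x powr s + B * x powr (s - \<delta>)"
      by (intro add_mono B x t)
    also have "\<dots> \<le> B * x powr s + B * x powr s"
      using assms(3) x by (intro add_left_mono mult_left_mono powr_mono B) auto
    finally have gt: "norm (g t) \<le> 2 * B * x powr s"
      by simp
    have "f t * g t - f x * g x = (f t - f x) * g t + f x * (g t - g x)"
      by (simp add: algebra_simps)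
    then have "norm (f t * g t - f x * g x) \<le> norm (f t - f x) * norm (g t) + norm (f x) * norm (g t - g x)"
      by (metis norm_triangle_ineq norm_mult)
    also have "\<dots> \<le> (A * x powr (r - \<delta>)) * (2 * B * x powr s) + (A * x powr r) * (B * x powr (s - \<delta>))"
      by (intro add_mono mult_mono A B x t gt mult_nonneg_nonneg) auto
    also have "\<dots> = 3 * A * B * x powr (r + s - \<delta>)"
      using x by (simp add: powr_add powr_diff field_simps)
    finally show "norm (f t * g t - f x * g x) \<le> 3 * A * B * x powr (r + s - \<delta>)" .
  qed
qed

lemma unit_step_bounded_const: "\<delta> \<ge> 0 \<Longrightarrow> unit_step_bounded 0 \<delta> (\<lambda>_. c)"
  by (rule unit_step_boundedI[of _ "norm c" _ 0]) auto

lemma unit_step_bounded_power: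
  assumes "unit_step_bounded r \<delta> f" "\<delta> \<ge> 0"
  shows "unit_step_bounded (real k * r) \<delta> (\<lambda>x. f x ^ k)"
proof (induction k)
  case 0
  show ?case
    using unit_step_bounded_const[OF assms(2), of 1] by simp
next
  case (Suc k)
  show ?case
    using unit_step_bounded_mult[OF assms(1) Suc assms(2)] by (simp add: algebra_simps)
qed

lemma unit_step_bounded_add:
  assumes "unit_step_bounded r \<delta> f" "unit_step_bounded r \<delta> g"
  shows "unit_step_bounded r \<delta> (\<lambda>x. f x + g x)"
proof -
  from assms(1) obtain A where A: "A \<ge> 0" "\<And>x. x \<ge> 1 \<Longrightarrow> norm (f x) \<le> A * x powr r"
    "\<And>x t. x \<ge> 1 \<Longrightarrow> x \<le> t \<Longrightarrow> t \<le> x + 1 \<Longrightarrow> norm (f t - f x) \<le> A * x powr (r - \<delta>)"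
    by (rule unit_step_boundedE) blast
  from assms(2) obtain B where B: "B \<ge> 0" "\<And>x. x \<ge> 1 \<Longrightarrow> norm (g x) \<le> B * x powr r"
    "\<And>x t. x \<ge> 1 \<Longrightarrow> x \<le> t \<Longrightarrow> t \<le> x + 1 \<Longrightarrow> norm (g t - g x) \<le> B * x powr (r - \<delta>)"
    by (rule unit_step_boundedE) blast
  show ?thesis
  proof (rule unit_step_boundedI)
    fix x :: real assume x: "x \<ge> 1"
    show "norm (f x + g x) \<le> (A + B) * x powr r"
      unfolding distrib_right by (rule norm_triangle_le, intro add_mono A B x)
    fix t assume t: "x \<le> t" "t \<le> x + 1"
    show "norm ((f t + g t) - (f x + g x)) \<le> (A + B) * x powr (r - \<delta>)"
      unfolding distrib_right add_diff_add by (rule norm_triangle_le, intro add_mono A B x t)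
  qed
qed

lemma unit_step_bounded_sum:
  assumes "\<And>i. i \<in> I \<Longrightarrow> unit_step_bounded r \<delta> (f i)"
  shows "unit_step_bounded r \<delta> (\<lambda>x. \<Sum>i\<in>I. f i x)"
  using assms
proof (induction I rule: infinite_finite_induct)
  case (insert i I)
  then show ?case
    using unit_step_bounded_add[of r \<delta> "f i" "\<lambda>x. \<Sum>i\<in>I. f i x"] by simp
qed (auto intro!: unit_step_boundedI[of _ 0 _ 0])

lemma ln_unit_step:
  fixes x t :: real
  assumes "x \<ge> 1" "x \<le> t" "t \<le> x + 1"
  shows "0 \<le> ln t - ln x" "ln t - ln x \<le> 1 / x"
proof -
  show "0 \<le> ln t - ln x"
    using assms by simp
  have "ln t - ln x = ln (t / x)"
    using assms by (simp add: ln_div)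
  also have "\<dots> \<le> t / x - 1"
    using assms by (intro ln_le_minus_one) auto
  also have "\<dots> \<le> 1 / x"
    using assms divide_right_mono[of t "x + 1" x] by (simp add: add_divide_distrib)
  finally show "ln t - ln x \<le> 1 / x" .
qed

text \<open>
  This is \<open>t powr \<kappa>\<close>, written as an exponential. Passing from \<open>x\<close> to \<open>t\<close> multiplies it by \<open>exp (\<kappa> * d)\<close> with
  \<open>0 \<le> d \<le> 1 / x\<close>, which differs from \<open>1\<close> by \<open>O(1 / x)\<close>.
\<close>
lemma unit_step_bounded_cpowr:
  assumes "\<delta> \<le> 1"
  shows "unit_step_bounded (Re \<kappa>) \<delta> (\<lambda>t. exp (\<kappa> * of_real (ln t)))"
proof (rule unit_step_boundedI)
  fix x :: real assume x: "x \<ge> 1"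
  show nx: "norm (exp (\<kappa> * of_real (ln x))) \<le> 1 * x powr Re \<kappa>"
    using x by (simp add: powr_def)
  fix t assume t: "x \<le> t" "t \<le> x + 1"
  define d where "d = ln t - ln x"
  have d: "0 \<le> d" "d \<le> 1 / x"
    using ln_unit_step[OF x t] by (simp_all add: d_def)
  have d1: "d \<le> 1"
    using d x by (smt (verit) divide_le_eq_1)
  \<comment> \<open>mean value inequality on a ball that contains \<open>\<kappa> * d\<close> because \<open>d \<le> 1\<close>\<close>
  have "norm (exp (\<kappa> * of_real d) - exp 0) \<le> exp (norm \<kappa>) * norm (\<kappa> * of_real d - 0)"
  proof (rule field_differentiable_bound[of "cball 0 (norm \<kappa>)"])
    show "norm (exp z) \<le> exp (norm \<kappa>)" if "z \<in> cball 0 (norm \<kappa>)" for z :: complex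
      using that norm_exp[of z] by (smt (verit) dist_0_norm exp_le_cancel_iff mem_cball)
    show "\<kappa> * of_real d \<in> cball 0 (norm \<kappa>)"
      using d(1) d1 by (simp add: norm_mult mult_left_le)
  qed (auto intro!: derivative_eq_intros)
  then have *: "norm (exp (\<kappa> * of_real d) - 1) \<le> exp (norm \<kappa>) * norm \<kappa> * d"
    using d(1) by (simp add: norm_mult)
  have "exp (\<kappa> * of_real (ln t)) - exp (\<kappa> * of_real (ln x))
      = exp (\<kappa> * of_real (ln x)) * (exp (\<kappa> * of_real d) - 1)"
    by (simp add: d_def algebra_simps flip: exp_add)
  then have "norm (exp (\<kappa> * of_real (ln t)) - exp (\<kappa> * of_real (ln x)))
      \<le> (1 * x powr Re \<kappa>) * (exp (norm \<kappa>) * norm \<kappa> * d)"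
    using mult_mono[OF nx *] by (simp add: norm_mult)
  also have "\<dots> \<le> (1 * x powr Re \<kappa>) * (exp (norm \<kappa>) * norm \<kappa> * x powr - \<delta>)"
  proof -
    have "d \<le> x powr (-1)"
      using d x by (simp add: powr_minus_divide)
    also have "\<dots> \<le> x powr - \<delta>"
      using assms x by (intro powr_mono) auto
    finally show ?thesis
      by (intro mult_left_mono) auto
  qed
  also have "\<dots> = (exp (norm \<kappa>) * norm \<kappa>) * x powr (Re \<kappa> - \<delta>)"
    by (simp add: powr_diff powr_minus field_simps)
  finally show "norm (exp (\<kappa> * of_real (ln t)) - exp (\<kappa> * of_real (ln x)))
      \<le> (exp (norm \<kappa>) * norm \<kappa>) * x powr (Re \<kappa> - \<delta>)" .
qed

text \<open>
  A logarithm costs an arbitrarily small power; this is where the exponent \<open>\<beta>\<close> becomes strictly less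
  than \<open>\<alpha>\<close> in the end.
\<close>
lemma unit_step_bounded_ln:
  assumes "\<delta> \<le> 1" "\<epsilon> > 0"
  shows "unit_step_bounded \<epsilon> \<delta> (\<lambda>t. of_real (ln t))"
proof (rule unit_step_boundedI)
  fix x :: real assume x: "x \<ge> 1"
  show "norm (of_real (ln x) :: complex) \<le> 1 / \<epsilon> * x powr \<epsilon>"
    using ln_powr_bound[OF x assms(2)] x by simp
  fix t assume t: "x \<le> t" "t \<le> x + 1"
  have "norm (of_real (ln t) - of_real (ln x) :: complex) \<le> 1 / x"
    using ln_unit_step[OF x t] by (metis abs_of_nonneg norm_of_real of_real_diff)
  also have "\<dots> = x powr (-1)"
    using x by (simp add: powr_minus_divide)
  also have "\<dots> \<le> x powr (\<epsilon> - \<delta>)"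
    using assms x by (intro powr_mono) auto
  finally show "norm (of_real (ln t) - of_real (ln x) :: complex) \<le> 1 * x powr (\<epsilon> - \<delta>)"
    by simp
qed

lemma hoelder_continuous_onE:
  assumes "hoelder_continuous_on \<alpha> S f"
  obtains C where "C \<ge> 0" "\<And>x y. x \<in> S \<Longrightarrow> y \<in> S \<Longrightarrow> dist (f x) (f y) \<le> C * dist x y powr \<alpha>"
proof -
  from assms obtain C where C: "\<forall>x\<in>S. \<forall>y\<in>S. dist (f x) (f y) \<le> C * dist x y powr \<alpha>"
    unfolding hoelder_continuous_on_def by blast
  show thesis
  proof (rule that[of "max 0 C"])
    fix x y assume "x \<in> S" "y \<in> S"
    then have "dist (f x) (f y) \<le> C * dist x y powr \<alpha>"
      using C by blast
    also have "\<dots> \<le> max 0 C * dist x y powr \<alpha>"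
      by (intro mult_right_mono) auto
    finally show "dist (f x) (f y) \<le> max 0 C * dist x y powr \<alpha>" .
  qed simp
qed

lemma hoelder_imp_continuous_on:
  assumes "hoelder_continuous_on \<alpha> S f" "\<alpha> > 0"
  shows "continuous_on S f"
proof -
  from assms(1) obtain C where C: "C \<ge> 0"
    "\<And>x y. x \<in> S \<Longrightarrow> y \<in> S \<Longrightarrow> dist (f x) (f y) \<le> C * dist x y powr \<alpha>"
    by (rule hoelder_continuous_onE) blast
  show ?thesis
    unfolding continuous_on_def
  proof
    fix x assume x: "x \<in> S"
    have *: "((\<lambda>y. C * dist y x powr \<alpha>) \<longlongrightarrow> C * 0) (at x within S)"
    proof (intro tendsto_mult tendsto_const)
      have "((\<lambda>y. dist y x) \<longlongrightarrow> 0) (at x within S)"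
        using tendsto_dist_iff[of "\<lambda>y. y" x "at x within S"] by simp
      then show "((\<lambda>y. dist y x powr \<alpha>) \<longlongrightarrow> 0) (at x within S)"
        using assms(2) by (intro tendsto_zero_powrI[where b = \<alpha>]) auto
    qed
    have "((\<lambda>y. dist (f y) (f x)) \<longlongrightarrow> 0) (at x within S)"
    proof (rule tendsto_sandwich[OF _ _ tendsto_const])
      show "((\<lambda>y. C * dist y x powr \<alpha>) \<longlongrightarrow> 0) (at x within S)"
        using * by simp
      show "\<forall>\<^sub>F y in at x within S. dist (f y) (f x) \<le> C * dist y x powr \<alpha>"
        using C(2) x by (auto simp: eventually_at_filter)
    qed simp
    then show "(f \<longlongrightarrow> f x) (at x within S)"
      using tendsto_dist_iff by blast
  qed
qed

lemma periodic_bounded: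
  fixes f :: "real \<Rightarrow> complex"
  assumes "continuous_on UNIV f" "\<And>x. f (x + 1) = f x"
  obtains B where "\<And>x. norm (f x) \<le> B"
proof -
  interpret periodic_fun_simple' f
    using assms(2) by unfold_locales
  have "bounded (f ` {0..1})"
    by (intro compact_imp_bounded compact_continuous_image continuous_on_subset[OF assms(1)]) auto
  then obtain B where B: "\<And>x. x \<in> {0..1} \<Longrightarrow> norm (f x) \<le> B"
    unfolding bounded_iff by blast
  show thesis
  proof (rule that[of B])
    fix x
    have "f x = f (frac x)"
      using plus_of_int[of "frac x" "\<lfloor>x\<rfloor>"] by (simp add: frac_def)
    also have "norm \<dots> \<le> B"
      using B[of "frac x"] frac_lt_1[of x] by (simp add: order.strict_implies_order)
    finally show "norm (f x) \<le> B" .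
  qed
qed

text \<open>
  Boundedness comes from periodicity. A unit step in \<open>t\<close> moves the argument \<open>ln t / \<tau>\<close> by \<open>O(1 / x)\<close>, and
  the Hoelder condition turns this into a gain of \<open>x powr - \<alpha>\<close>.
\<close>
lemma unit_step_bounded_periodic:
  assumes "hoelder_continuous_on \<alpha> UNIV f" "\<alpha> > 0" "\<And>x. f (x + 1) = f x" "\<tau> > 0"
  shows "unit_step_bounded 0 \<alpha> (\<lambda>t. f (ln t / \<tau>))"
proof -
  from assms(1) obtain C where C: "C \<ge> 0"
    "\<And>x y. dist (f x) (f y) \<le> C * dist x y powr \<alpha>"
    using hoelder_continuous_onE[of \<alpha> UNIV f] by auto
  obtain B where B: "\<And>x. norm (f x) \<le> B"
    using periodic_bounded[OF hoelder_imp_continuous_on[OF assms(1,2)] assms(3)] by blast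
  show ?thesis
  proof (rule unit_step_boundedI)
    fix x :: real assume x: "x \<ge> 1"
    show "norm (f (ln x / \<tau>)) \<le> B * x powr 0"
      using B x by simp
    fix t assume t: "x \<le> t" "t \<le> x + 1"
    have "norm (f (ln t / \<tau>) - f (ln x / \<tau>)) \<le> C * dist (ln t / \<tau>) (ln x / \<tau>) powr \<alpha>"
      using C(2) by (simp add: dist_norm)
    also have "dist (ln t / \<tau>) (ln x / \<tau>) = (ln t - ln x) / \<tau>"
      using ln_unit_step(1)[OF x t] assms(4)
      by (simp add: dist_real_def abs_of_nonneg flip: diff_divide_distrib)
    also have "C * ((ln t - ln x) / \<tau>) powr \<alpha> \<le> C * ((1 / x) / \<tau>) powr \<alpha>"
      using ln_unit_step[OF x t] assms(2,4) C(1)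
      by (intro mult_left_mono powr_mono2 divide_right_mono) auto
    also have "\<dots> = (C / \<tau> powr \<alpha>) * x powr (0 - \<alpha>)"
      using x assms(4) by (simp add: powr_divide powr_mult powr_minus field_simps)
    finally show "norm (f (ln t / \<tau>) - f (ln x / \<tau>)) \<le> (C / \<tau> powr \<alpha>) * x powr (0 - \<alpha>)" .
  qed
qed

lemma unit_step_bounded_summand:
  fixes \<Phi> :: "nat \<Rightarrow> real \<Rightarrow> complex"
  assumes "\<And>j. j < m \<Longrightarrow> hoelder_continuous_on \<alpha> UNIV (\<Phi> j)"
    and "\<And>j x. j < m \<Longrightarrow> \<Phi> j (x + 1) = \<Phi> j x"
    and "0 < \<alpha>" "\<alpha> \<le> 1" "\<tau> > 0" "\<eta> > 0"
  shows "unit_step_bounded (Re \<kappa> + \<eta>) \<alpha> (\<lambda>t. exp (\<kappa> * of_real (ln t)) *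
    (\<Sum>j<m. of_real (ln t) ^ (m - 1 - j) / fact (m - 1 - j) * \<Phi> j (ln t / \<tau>)))"
proof (intro unit_step_bounded_mult unit_step_bounded_cpowr unit_step_bounded_sum)
  fix j assume "j \<in> {..<m}"
  then have j: "j < m" by simp
  define k where "k = m - 1 - j"
  \<comment> \<open>at most \<open>m - 1\<close> logarithms occur, so \<open>\<eta> / m\<close> may be spent on each\<close>
  define \<epsilon> where "\<epsilon> = \<eta> / m"
  have "\<epsilon> > 0"
    using j assms(6) by (simp add: \<epsilon>_def)
  have "unit_step_bounded (real k * \<epsilon> + 0 + 0) \<alpha>
      (\<lambda>t. of_real (ln t) ^ k * (1 / fact k) * \<Phi> j (ln t / \<tau>))"
    using assms j \<open>\<epsilon> > 0\<close>
    by (intro unit_step_bounded_mult unit_step_bounded_power unit_step_bounded_ln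
        unit_step_bounded_const unit_step_bounded_periodic) auto
  moreover have "real k * \<epsilon> + 0 + 0 \<le> \<eta>"
  proof -
    have "real k * \<epsilon> \<le> real m * \<epsilon>"
      using \<open>\<epsilon> > 0\<close> by (intro mult_right_mono) (auto simp: k_def)
    then show ?thesis
      using j by (simp add: \<epsilon>_def)
  qed
  ultimately have "unit_step_bounded \<eta> \<alpha>
      (\<lambda>t. of_real (ln t) ^ k * (1 / fact k) * \<Phi> j (ln t / \<tau>))"
    by (rule unit_step_bounded_weaken)
  then show "unit_step_bounded \<eta> \<alpha>
      (\<lambda>t. of_real (ln t) ^ (m - 1 - j) / fact (m - 1 - j) * \<Phi> j (ln t / \<tau>))"
    by (simp add: k_def)
qed (use assms in auto)

section \<open>From antiderivatives to sums\<close>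

text \<open>
  Powers with exponent \<open>p - 1\<close> are dominated by a telescoping sequence. By the mean value theorem the
  difference quotient is \<open>z powr (p - 1)\<close> with \<open>n < z < n + 1\<close>, and \<open>z / n\<close> lies between \<open>1\<close> and \<open>2\<close>;
  the absolute value covers both monotonicities of the power.
\<close>
lemma powr_le_difference:
  assumes "p \<noteq> 0" "n \<ge> (1::real)"
  shows "n powr (p - 1) \<le> 2 powr \<bar>p - 1\<bar> * (((n + 1) powr p - n powr p) / p)"
proof -
  obtain z where z: "z > n" "z < n + 1" "(n + 1) powr p - n powr p = (n + 1 - n) * (p * z powr (p - 1))"
    using MVT2[of n "n + 1" "\<lambda>x. x powr p" "\<lambda>x. p * x powr (p - 1)"]
      has_real_derivative_powr[of _ p] assms(2) by auto
  have "n powr (p - 1) = (n / z) powr (p - 1) * z powr (p - 1)"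
    using assms z by (simp add: powr_divide)
  also have "(n / z) powr (p - 1) \<le> 2 powr \<bar>p - 1\<bar>"
  proof (cases "p \<ge> 1")
    case True
    have "(n / z) powr (p - 1) \<le> 1 powr (p - 1)"
      using True assms z by (intro powr_mono2) auto
    also have "1 powr (p - 1) \<le> 2 powr \<bar>p - 1\<bar>"
      by (simp add: ge_one_powr_ge_zero)
    finally show ?thesis .
  next
    case False
    have "(n / z) powr (p - 1) = (z / n) powr (1 - p)"
      using assms z powr_minus_divide[of "n / z" "1 - p"] by (simp add: powr_divide)
    also have "\<dots> \<le> 2 powr (1 - p)"
      using False assms z by (intro powr_mono2) (auto simp: field_simps)
    finally show ?thesis
      using False by simp
  qed
  finally have "n powr (p - 1) \<le> 2 powr \<bar>p - 1\<bar> * z powr (p - 1)"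
    by (simp add: mult_right_mono)
  then show ?thesis
    using z(3) assms by simp
qed

text \<open>
  The terms are bounded by the increments of \<open>h n = K * n powr p\<close>. For \<open>p > 0\<close> this bounds the partial sums
  themselves, so that \<open>c = 0\<close> will do. For \<open>p < 0\<close> the function \<open>h\<close> is nonpositive and tends to zero, so the
  series converges, \<open>c\<close> is its sum, and the tail is at most \<open>- h N\<close>. For \<open>p = 0\<close> a logarithm would
  appear.
\<close>
lemma sum_powr_bounded_asymptotics:
  fixes D :: "nat \<Rightarrow> complex"
  assumes "p \<noteq> 0" "\<And>n. n \<ge> 1 \<Longrightarrow> norm (D n) \<le> C * real n powr (p - 1)"
  shows "\<exists>c. (\<lambda>N. (\<Sum>n\<in>{1..<N}. D n) - c) \<in> O(\<lambda>N. of_real (real N powr p))"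
proof -
  have "0 \<le> C"
    using assms(2)[of 1] norm_ge_zero[of "D 1"] by (simp del: norm_ge_zero)
  define K where "K = C * 2 powr \<bar>p - 1\<bar> / p"
  define h where "h n = K * real n powr p" for n
  have D: "norm (D n) \<le> h (Suc n) - h n" if "n \<ge> 1" for n
  proof -
    have "norm (D n) \<le> C * (2 powr \<bar>p - 1\<bar> * (((real n + 1) powr p - real n powr p) / p))"
      by (rule order_trans[OF assms(2)[OF that]], intro mult_left_mono powr_le_difference)
        (use assms(1) that \<open>0 \<le> C\<close> in auto)
    also have "\<dots> = h (Suc n) - h n"
      by (simp add: h_def K_def diff_divide_distrib right_diff_distrib add.commute mult_ac)
    finally show ?thesis .
  qed
  have tele: "norm (\<Sum>n\<in>{M..<N}. D n) \<le> h N - h M" if "1 \<le> M" "M \<le> N" for M N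
  proof -
    have "norm (\<Sum>n\<in>{M..<N}. D n) \<le> (\<Sum>n\<in>{M..<N}. h (Suc n) - h n)"
      using that by (intro sum_norm_le D) auto
    also have "\<dots> = h N - h M"
      using that by (simp add: sum_Suc_diff')
    finally show ?thesis .
  qed
  show ?thesis
  proof (cases "p > 0")
    case True
    have "norm (\<Sum>n\<in>{1..<N}. D n) \<le> K * norm (of_real (real N powr p) :: complex)" if "N \<ge> 1" for N
    proof -
      have "h 1 \<ge> 0"
        using True \<open>0 \<le> C\<close> by (simp add: h_def K_def)
      then show ?thesis
        using tele[of 1 N] that by (simp add: h_def)
    qed
    then have "(\<lambda>N. (\<Sum>n\<in>{1..<N}. D n) - 0) \<in> O(\<lambda>N. of_real (real N powr p))"
      by (intro bigoI[of _ K]) (auto simp: eventually_at_top_linorder)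
    then show ?thesis by blast
  next
    case False
    then have p: "p < 0" using assms(1) by simp
    have "(\<lambda>n. real n powr p) \<longlonglongrightarrow> 0"
      using p by (intro tendsto_neg_powr filterlim_real_sequentially)
    then have h0: "h \<longlonglongrightarrow> 0"
      unfolding h_def using tendsto_mult_right_zero by blast
    have "summable (\<lambda>n. h (Suc n) - h n)"
      using telescope_summable[OF h0] .
    then have "summable D"
      by (rule summable_comparison_test'[where N = 1]) (use D in auto)
    then have "(\<lambda>N. \<Sum>n<N. D n) \<longlonglongrightarrow> suminf D"
      by (rule summable_LIMSEQ)
    moreover have "(\<Sum>n<N. D n) = D 0 + (\<Sum>n\<in>{1..<N}. D n)" if "N \<ge> 1" for N
      using that by (simp add: lessThan_atLeast0 sum.atLeast_Suc_lessThan)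
    ultimately have "(\<lambda>N. D 0 + (\<Sum>n\<in>{1..<N}. D n)) \<longlonglongrightarrow> suminf D"
      by (metis (mono_tags, lifting) Lim_transform_eventually eventually_sequentiallyI)
    then have lim: "(\<lambda>N. \<Sum>n\<in>{1..<N}. D n) \<longlonglongrightarrow> suminf D - D 0"
      using tendsto_diff[OF _ tendsto_const[of "D 0"]] by fastforce
    \<comment> \<open>the term with index \<open>0\<close> belongs to the series but not to the sums\<close>
    define c where "c = suminf D - D 0"
    have "norm ((\<Sum>n\<in>{1..<N}. D n) - c) \<le> - K * norm (of_real (real N powr p) :: complex)" if N: "N \<ge> 1" for N
    proof -
      have "(\<lambda>M. norm ((\<Sum>n\<in>{1..<N}. D n) - (\<Sum>n\<in>{1..<M}. D n))) \<longlonglongrightarrow> norm ((\<Sum>n\<in>{1..<N}. D n) - c)"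
        using lim by (intro tendsto_intros) (simp add: c_def)
      moreover have "(\<lambda>M. h M - h N) \<longlonglongrightarrow> 0 - h N"
        by (intro tendsto_diff h0 tendsto_const)
      moreover have "norm ((\<Sum>n\<in>{1..<N}. D n) - (\<Sum>n\<in>{1..<M}. D n)) \<le> h M - h N" if "M \<ge> N" for M
      proof -
        have "(\<Sum>n\<in>{1..<M}. D n) = (\<Sum>n\<in>{1..<N}. D n) + (\<Sum>n\<in>{N..<M}. D n)"
          using that N by (simp add: sum.atLeastLessThan_concat)
        then show ?thesis
          using tele[OF N that] by simp
      qed
      ultimately have "norm ((\<Sum>n\<in>{1..<N}. D n) - c) \<le> 0 - h N"
        by (intro LIMSEQ_le) blast+
      then show ?thesis
        by (simp add: h_def)
    qed
    then have "(\<lambda>N. (\<Sum>n\<in>{1..<N}. D n) - c) \<in> O(\<lambda>N. of_real (real N powr p))"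
      by (intro bigoI[of _ "- K"]) (auto simp: eventually_at_top_linorder)
    then show ?thesis by blast
  qed
qed

text \<open>
  Telescoping \<open>F (n + 1) - F n\<close> leaves the sum of the deviations \<open>F (n + 1) - F n - g n\<close>, and the mean value
  inequality bounds each of them by the oscillation of \<open>g = F'\<close> on \<open>[n, n + 1]\<close>.
\<close>
lemma summation_by_antiderivative:
  fixes F g :: "real \<Rightarrow> complex"
  assumes "\<And>t. t > 0 \<Longrightarrow> (F has_vector_derivative g t) (at t)"
    and "unit_step_bounded r \<delta> g" "r - \<delta> \<noteq> -1"
  shows "\<exists>c. (\<lambda>N. (\<Sum>n\<in>{1..<N}. g (real n)) - (c + F (real N)))
    \<in> O(\<lambda>N. of_real (real N powr (r - \<delta> + 1)))"
proof -
  obtain C where C: "\<And>x t. x \<ge> 1 \<Longrightarrow> x \<le> t \<Longrightarrow> t \<le> x + 1 \<Longrightarrow> norm (g t - g x) \<le> C * x powr (r - \<delta>)"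
    using assms(2) by (rule unit_step_boundedE) (rule that)
  define D where "D n = F (real n + 1) - F (real n) - g (real n)" for n
  have D: "norm (D n) \<le> C * real n powr (r - \<delta> + 1 - 1)" if "n \<ge> 1" for n
  proof -
    have "norm (F (real n + 1) - F (real n) - (real n + 1 - real n) *\<^sub>R g (real n))
        \<le> norm (real n + 1 - real n) * (C * real n powr (r - \<delta>))"
    proof (rule vector_differentiable_bound_linearization[of "{real n..real n + 1}"])
      show "(F has_vector_derivative g x) (at x within {real n..real n + 1})"
        if "x \<in> {real n..real n + 1}" for x
        by (rule has_vector_derivative_at_within[OF assms(1)]) (use that \<open>n \<ge> 1\<close> in simp)
      show "norm (g x - g (real n)) \<le> C * real n powr (r - \<delta>)"
        if "x \<in> {real n..real n + 1}" for x
        by (rule C) (use that \<open>n \<ge> 1\<close> in simp_all)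
    qed (simp_all add: closed_segment_eq_real_ivl)
    then show ?thesis
      by (simp add: D_def)
  qed
  have "r - \<delta> + 1 \<noteq> 0"
    using assms(3) by simp
  from sum_powr_bounded_asymptotics[OF this D]
  obtain c where c: "(\<lambda>N. (\<Sum>n\<in>{1..<N}. D n) - c) \<in> O(\<lambda>N. of_real (real N powr (r - \<delta> + 1)))"
    by (rule exE)
  have "(\<lambda>N. (\<Sum>n\<in>{1..<N}. g (real n)) - (- F 1 - c + F (real N)))
    \<in> O(\<lambda>N. of_real (real N powr (r - \<delta> + 1)))"
  proof -
    have "(\<Sum>n\<in>{1..<N}. g (real n)) - (- F 1 - c + F (real N)) = - ((\<Sum>n\<in>{1..<N}. D n) - c)"
      if "N \<ge> 1" for N
    proof -
      have "(\<Sum>n\<in>{1..<N}. D n) = (\<Sum>n\<in>{1..<N}. F (real (Suc n)) - F (real n)) - (\<Sum>n\<in>{1..<N}. g (real n))"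
        by (simp add: D_def sum_subtractf add.commute)
      also have "(\<Sum>n\<in>{1..<N}. F (real (Suc n)) - F (real n)) = F (real N) - F 1"
        using sum_Suc_diff'[of 1 N "\<lambda>n. F (real n)"] that by simp
      finally show ?thesis
        by simp
    qed
    then have ev: "eventually (\<lambda>N. (\<Sum>n\<in>{1..<N}. g (real n)) - (- F 1 - c + F (real N))
        = - ((\<Sum>n\<in>{1..<N}. D n) - c)) at_top"
      by (auto simp: eventually_at_top_linorder)
    have "(\<lambda>N. - ((\<Sum>n\<in>{1..<N}. D n) - c)) \<in> O(\<lambda>N. of_real (real N powr (r - \<delta> + 1)))"
      using c by (simp only: landau_o.big.uminus_in_iff)
    then show ?thesis
      unfolding landau_o.big.in_cong[OF ev] .
  qed
  then show ?thesis ..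
qed

section \<open>The summation theorem\<close>

lemma sum_shift_index:
  "(\<Sum>j\<in>{-1..<int m}. f j) = (\<Sum>n\<le>m. f (int n - 1))"
  by (rule sum.reindex_bij_witness[where i = "\<lambda>n. int n - 1" and j = "\<lambda>j. nat (j + 1)"]) auto

text \<open>
  The factor \<open>s\<close> reproduces \<open>\<phi> n - \<psi> n\<close> at \<open>Z ^ n\<close> and kills the polar term, while the factor \<open>Z\<close> adds \<open>\<psi> n\<close> back
  at \<open>Z ^ n\<close>. The top coefficient \<open>\<psi> m\<close> has no counterpart and is the remainder.
\<close>
lemma generating_function_identity:
  fixes \<phi> \<psi> :: "nat \<Rightarrow> complex"
  assumes "s * \<psi> 0 = 0" "\<And>n. n < m \<Longrightarrow> \<phi> n - \<psi> n = s * \<psi> (Suc n)" "Z \<noteq> 0"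
  shows "(\<Sum>j<m. \<phi> j * Z ^ j) - (s + Z) * (\<Sum>n\<le>m. \<psi> n * Z powi (int n - 1)) = - \<psi> m * Z ^ m"
proof -
  have Z: "Z * Z powi (int n - 1) = Z ^ n" for n
    using assms(3) by (simp add: power_int_diff)
  have "Z * (\<Sum>n\<le>m. \<psi> n * Z powi (int n - 1)) = (\<Sum>n\<le>m. \<psi> n * Z ^ n)"
    unfolding sum_distrib_left by (intro sum.cong refl) (simp only: mult.left_commute[of Z] Z)
  moreover have "s * (\<Sum>n\<le>m. \<psi> n * Z powi (int n - 1)) = (\<Sum>n<m. (\<phi> n - \<psi> n) * Z ^ n)"
  proof -
    have "s * (\<Sum>n\<le>m. \<psi> n * Z powi (int n - 1)) = (\<Sum>n\<le>m. (s * \<psi> n) * Z powi (int n - 1))"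
      by (simp add: sum_distrib_left mult.assoc)
    also have "\<dots> = (\<Sum>n<m. (s * \<psi> (Suc n)) * Z ^ n)"
      by (subst sum.atMost_shift) (simp add: assms(1))
    also have "\<dots> = (\<Sum>n<m. (\<phi> n - \<psi> n) * Z ^ n)"
      using assms(2) by (intro sum.cong) auto
    finally show ?thesis .
  qed
  moreover have "(\<Sum>n\<le>m. \<psi> n * Z ^ n) = (\<Sum>n<m. \<psi> n * Z ^ n) + \<psi> m * Z ^ m"
    by (simp flip: lessThan_Suc_atMost)
  ultimately show ?thesis
    by (simp add: distrib_right left_diff_distrib sum_subtractf)
qed

theorem theorem3:
  fixes \<kappa> :: complex and q \<alpha> \<beta> :: real and m :: nat
    and \<Phi> :: "nat \<Rightarrow> real \<Rightarrow> complex"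
  assumes "q > 1" and "m > 0"
    and "0 < \<alpha>" and "\<alpha> \<le> 1"
    and "\<And>j x. j < m \<Longrightarrow> \<Phi> j (x + 1) = \<Phi> j x"
    and "\<And>j. j < m \<Longrightarrow> hoelder_continuous_on \<alpha> UNIV (\<Phi> j)"
    and "0 < \<beta>" and "\<beta> < \<alpha>"
  shows "\<exists>(\<Psi> :: int \<Rightarrow> real \<Rightarrow> complex) (c :: complex).
    (\<forall>j\<in>{-1..<int m}. \<Psi> j C1_differentiable_on UNIV \<and> (\<forall>x. \<Psi> j (x + 1) = \<Psi> j x)) \<and>
    (\<lambda>N::nat.
        (\<Sum>n\<in>{1..<N}. of_nat n powr \<kappa> *
          (\<Sum>j<m. of_real (ln (real n)) ^ (m - 1 - j) / fact (m - 1 - j) * \<Phi> j (log q (real n))))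
        - (c + of_nat N powr (\<kappa> + 1) *
          (\<Sum>j\<in>{-1..<int m}. of_real (ln (real N)) ^ nat (int m - 1 - j) / fact (nat (int m - 1 - j))
             * \<Psi> j (log q (real N)))))
      \<in> O(\<lambda>N. of_real (real N powr (Re \<kappa> + 1 - \<beta>))) \<and>
    (\<forall>l::int.
      (\<lambda>Z::complex.
        (\<Sum>j<m. fourier_coeff (\<Phi> j) l * Z ^ j)
        - (\<kappa> + 1 + 2 * of_int l * of_real pi * \<i> / of_real (ln q) + Z) *
          (\<Sum>j\<in>{-1..<int m}. fourier_coeff (\<Psi> j) l * Z powi j))
      \<in> O[at 0](\<lambda>Z. Z ^ m)) \<and>
    (of_real q powr (\<kappa> + 1) \<noteq> 1 \<longrightarrow> (\<forall>x. \<Psi> (-1) x = 0))"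
proof -
  define \<tau> where "\<tau> = ln q"
  have \<tau>: "\<tau> > 0"
    using assms(1) by (simp add: \<tau>_def)
  \<comment> \<open>extended by zero so that the tower can be built without an upper end\<close>
  define F where "F n = (if n < m then \<Phi> n else (\<lambda>_. 0))" for n
  have F_cont: "continuous_on UNIV (F n)" for n
    using hoelder_imp_continuous_on[OF assms(6,3)] by (simp add: F_def)
  have F_per: "F n (u + 1) = F n u" for n u
    using assms(5) by (simp add: F_def)
  obtain y where y0: "periodic_ode_solution (\<kappa> + 1) \<tau> (\<lambda>_. 0) (y 0)"
    and ySuc: "\<And>n. periodic_ode_solution (\<kappa> + 1) \<tau> (\<lambda>u. F n u - y n u) (y (Suc n))"
    and y_cont: "\<And>n. continuous_on UNIV (y n)" and y_C1: "\<And>n. y n C1_differentiable_on UNIV"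
    and y_zero: "exp ((\<kappa> + 1) * of_real \<tau>) \<noteq> 1 \<Longrightarrow> y 0 = (\<lambda>_. 0)"
    by (rule periodic_ode_tower[where F = F and \<mu> = "\<kappa> + 1", OF \<tau> F_cont F_per]) blast
  have y_per: "y n (u + 1) = y n u" for n u
    using y0 ySuc by (cases n) (auto simp: periodic_ode_solution_def)
  have ySuc': "periodic_ode_solution (\<kappa> + 1) \<tau> (\<lambda>u. \<Phi> n u - y n u) (y (Suc n))" if "n < m" for n
    using ySuc[of n] that by (simp add: F_def)
  \<comment> \<open>shifts the indices, which start at \<open>-1\<close> for \<open>\<Psi>\<close>\<close>
  define \<Psi> where "\<Psi> j = y (nat (j + 1))" for j :: int
  have \<Psi>: "\<Psi> (int n - 1) = y n" for n
    by (simp add: \<Psi>_def)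

  define g where "g t = exp (\<kappa> * of_real (ln t)) *
    (\<Sum>j<m. of_real (ln t) ^ (m - 1 - j) / fact (m - 1 - j) * \<Phi> j (ln t / \<tau>))" for t
  define G where "G t = exp ((\<kappa> + 1) * of_real (ln t)) *
      (\<Sum>n\<le>m. of_real (ln t) ^ (m - n) / fact (m - n) * y n (ln t / \<tau>))" for t
  have G: "(G has_vector_derivative g t) (at t)" if "t > 0" for t
    unfolding G_def g_def
    by (rule log_polynomial_antiderivative[where y = y and F = \<Phi>, OF \<tau> y0 ySuc' that])
  \<comment> \<open>any \<open>\<gamma>\<close> strictly between \<open>\<beta>\<close> and \<open>\<alpha>\<close> except the one that would produce a logarithm\<close>
  obtain \<gamma> where \<gamma>: "\<beta> < \<gamma>" "\<gamma> < \<alpha>" "\<gamma> \<noteq> Re \<kappa> + 1"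
  proof -
    obtain x where x: "\<beta> < x" "x < \<alpha>"
      using dense[OF assms(8)] by blast
    obtain z where "\<beta> < z" "z < x"
      using dense[OF x(1)] by blast
    then show thesis
      using that[of x] that[of z] x by fastforce
  qed
  have g: "unit_step_bounded (Re \<kappa> + (\<alpha> - \<gamma>)) \<alpha> g"
    unfolding g_def by (rule unit_step_bounded_summand) (use assms \<tau> \<gamma>(2) in simp_all)
  have "\<exists>c. (\<lambda>N. (\<Sum>n\<in>{1..<N}. g (real n)) - (c + G (real N)))
    \<in> O(\<lambda>N. of_real (real N powr (Re \<kappa> + (\<alpha> - \<gamma>) - \<alpha> + 1)))"
    by (rule summation_by_antiderivative[where F = G and g = g, OF _ g]) (use G \<gamma>(3) in simp_all)
  then obtain c where c: "(\<lambda>N. (\<Sum>n\<in>{1..<N}. g (real n)) - (c + G (real N)))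
    \<in> O(\<lambda>N. of_real (real N powr (Re \<kappa> + 1 - \<gamma>)))"
    by (auto simp: algebra_simps)

  \<comment> \<open>fails at \<open>0\<close>, where the left-hand side is \<open>0\<close> and the right-hand side is \<open>1\<close>; hence the restriction to \<open>N \<ge> 1\<close> below\<close>
  have power_exp: "of_nat n powr z = exp (z * of_real (ln (real n)))" if "n \<ge> 1" for n and z :: complex
    using that Ln_of_real[of "real n"] by (simp add: powr_def)
  have asymptotics: "(\<lambda>N::nat.
        (\<Sum>n\<in>{1..<N}. of_nat n powr \<kappa> *
          (\<Sum>j<m. of_real (ln (real n)) ^ (m - 1 - j) / fact (m - 1 - j) * \<Phi> j (log q (real n))))
        - (c + of_nat N powr (\<kappa> + 1) *
          (\<Sum>j\<in>{-1..<int m}. of_real (ln (real N)) ^ nat (int m - 1 - j) / fact (nat (int m - 1 - j))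
             * \<Psi> j (log q (real N)))))
      \<in> O(\<lambda>N. of_real (real N powr (Re \<kappa> + 1 - \<beta>)))" (is "?E \<in> _")
  proof -
    have E_eq: "eventually (\<lambda>N. ?E N = (\<Sum>n\<in>{1..<N}. g (real n)) - (c + G (real N))) at_top"
      unfolding eventually_at_top_linorder
    proof (intro exI[of _ 1] allI impI)
      fix N :: nat assume N: "N \<ge> 1"
      have "(\<Sum>n\<in>{1..<N}. of_nat n powr \<kappa> *
          (\<Sum>j<m. of_real (ln (real n)) ^ (m - 1 - j) / fact (m - 1 - j) * \<Phi> j (log q (real n))))
        = (\<Sum>n\<in>{1..<N}. g (real n))"
        by (intro sum.cong refl) (simp add: power_exp g_def log_def \<tau>_def)
      moreover have "of_nat N powr (\<kappa> + 1) *
          (\<Sum>j\<in>{-1..<int m}. of_real (ln (real N)) ^ nat (int m - 1 - j) / fact (nat (int m - 1 - j))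
             * \<Psi> j (log q (real N))) = G (real N)"
      proof -
        have "nat (int m - int n) = m - n" for n
          by simp
        then show ?thesis
          unfolding sum_shift_index \<Psi> G_def power_exp[OF N] log_def \<tau>_def by simp
      qed
      ultimately show "?E N = (\<Sum>n\<in>{1..<N}. g (real n)) - (c + G (real N))"
        by simp
    qed
    have "(\<lambda>N. of_real (real N powr (Re \<kappa> + 1 - \<gamma>)) :: complex)
        \<in> O(\<lambda>N. of_real (real N powr (Re \<kappa> + 1 - \<beta>)))"
    proof (intro bigoI[of _ 1] eventually_at_top_linorderI[of 1])
      fix N :: nat assume "N \<ge> 1"
      then show "norm (of_real (real N powr (Re \<kappa> + 1 - \<gamma>)) :: complex)
          \<le> 1 * norm (of_real (real N powr (Re \<kappa> + 1 - \<beta>)) :: complex)"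
        using \<gamma>(1) powr_mono[of "Re \<kappa> + 1 - \<gamma>" "Re \<kappa> + 1 - \<beta>" "real N"] by simp
    qed
    from landau_o.big_trans[OF c this] have "(\<lambda>N. (\<Sum>n\<in>{1..<N}. g (real n)) - (c + G (real N)))
        \<in> O(\<lambda>N. of_real (real N powr (Re \<kappa> + 1 - \<beta>)))" .
    then show ?thesis
      unfolding landau_o.big.in_cong[OF E_eq] .
  qed

  have fourier: "(\<lambda>Z::complex.
        (\<Sum>j<m. fourier_coeff (\<Phi> j) l * Z ^ j)
        - (\<kappa> + 1 + 2 * of_int l * of_real pi * \<i> / of_real (ln q) + Z) *
          (\<Sum>j\<in>{-1..<int m}. fourier_coeff (\<Psi> j) l * Z powi j))
      \<in> O[at 0](\<lambda>Z. Z ^ m)" (is "?f \<in> _") for l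
  proof -
    define s where "s = \<kappa> + 1 + 2 * of_int l * of_real pi * \<i> / of_real \<tau>"
    define \<psi> where "\<psi> n = fourier_coeff (y n) l" for n
    have s0: "s * \<psi> 0 = 0"
      using fourier_coeff_ode[OF y0 \<tau>, of l] by (simp add: s_def \<psi>_def fourier_coeff_def)
    have sSuc: "fourier_coeff (\<Phi> n) l - \<psi> n = s * \<psi> (Suc n)" if "n < m" for n
    proof -
      have "continuous_on UNIV (\<Phi> n)"
        using hoelder_imp_continuous_on[OF assms(6,3)] that by blast
      then show ?thesis
        using fourier_coeff_ode[OF ySuc'[OF that] \<tau>, of l] y_cont
        by (simp add: s_def \<psi>_def fourier_coeff_diff continuous_on_diff)
    qed
    have "?f Z = - \<psi> m * Z ^ m" if "Z \<noteq> 0" for Z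
      using generating_function_identity[of s \<psi> m "\<lambda>n. fourier_coeff (\<Phi> n) l", OF s0 sSuc that]
      unfolding sum_shift_index \<Psi> s_def \<psi>_def \<tau>_def by simp
    then have "norm (?f Z) \<le> norm (\<psi> m) * norm (Z ^ m)" if "Z \<noteq> 0" for Z
      using that by (simp add: norm_mult)
    then show ?thesis
      by (intro bigoI[of _ "norm (\<psi> m)"]) (simp add: eventually_at_filter)
  qed

  have vanishing: "of_real q powr (\<kappa> + 1) \<noteq> 1 \<longrightarrow> (\<forall>x. \<Psi> (-1) x = 0)"
  proof
    assume "of_real q powr (\<kappa> + 1) \<noteq> 1"
    moreover have "of_real q powr (\<kappa> + 1) = exp ((\<kappa> + 1) * of_real \<tau>)"
      using assms(1) Ln_of_real[of q] by (simp add: powr_def \<tau>_def)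
    ultimately show "\<forall>x. \<Psi> (-1) x = 0"
      using y_zero by (simp add: \<Psi>_def)
  qed
  have regularity: "\<forall>j\<in>{-1..<int m}. \<Psi> j C1_differentiable_on UNIV \<and> (\<forall>x. \<Psi> j (x + 1) = \<Psi> j x)"
    by (simp add: \<Psi>_def y_C1 y_per)
  show ?thesis
    by (rule exI[of _ \<Psi>], rule exI[of _ c])
      (rule conjI[OF regularity conjI[OF asymptotics conjI[OF allI[OF fourier] vanishing]]])
qed

end
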